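(* Let $q$ be a complex number with $0<|q|<1$. (1) For every complex $\nu\neq0$, with $\bar\nu=1/\nu$, such that all denominators below (including those in the series) are nonzero, $$\frac{1-q^2}{1-\nu^2}=\frac{\begin{array}{l}{}_2\phi_1(\nu,-\nu;-\nu^2q;q,q^3)\;{}_2\phi_1(-\bar\nu,\bar\nu;-\bar\nu^2q;q,q^4)\\ \quad+\nu^2\,{}_2\phi_1(-\bar\nu,\bar\nu;-\bar\nu^2q;q,q^3)\;{}_2\phi_1(\nu,-\nu;-\nu^2q;q,q^4)\end{array}}{\begin{array}{l}{}_2\phi_1(\nu,-\nu;-\nu^2q;q,q^2)\;{}_2\phi_1(-\bar\nu,\bar\nu;-\bar\nu^2q;q,q^4)\\ \quad-\nu^4\,{}_2\phi_1(-\bar\nu,\bar\nu;-\bar\nu^2q;q,q^2)\;{}_2\phi_1(\nu,-\nu;-\nu^2q;q,q^4)\end{array}}\,.$$ (2) For every complex $\mu\neq0$, with $\bar\mu=1/\mu$ and $\bar q=1/q$, such that all denominators below (including those in the series) are nonzero, $$\frac{1-q}{1-\mu^2\bar q}=\frac{\begin{array}{l}{}_2\phi_1(\mu,-\mu;-\mu^2;q,q^2)\;{}_2\phi_1(-q\bar\mu,q\bar\mu;-q^2\bar\mu^2;q,q^3)\\ \quad+\mu^2\bar q\,{}_2\phi_1(-q\bar\mu,q\bar\mu;-q^2\bar\mu^2;q,q^2)\;{}_2\phi_1(\mu,-\mu;-\mu^2;q,q^3)\end{array}}{\begin{array}{l}{}_2\phi_1(\mu,-\mu;-\mu^2;q,q)\;{}_2\phi_1(-q\bar\mu,q\bar\mu;-q^2\bar\mu^2;q,q^3)\\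 \quad-\mu^4\bar q^2\,{}_2\phi_1(-q\bar\mu,q\bar\mu;-q^2\bar\mu^2;q,q)\;{}_2\phi_1(\mu,-\mu;-\mu^2;q,q^3)\end{array}}\,.$$
   Context: Here $(a;q)_n=\prod_{k=0}^{n-1}(1-aq^k)$ and $${}_2\phi_1(a,b;c;q,x)=\sum_{k=0}^{\infty}\frac{(a;q)_k(b;q)_k\,x^k}{(c;q)_k(q;q)_k}$$ is the basic hypergeometric function. *)

theory Defs
  imports "HOL-Analysis.Analysis"
begin

definition qpoch :: "complex \<Rightarrow> complex \<Rightarrow> nat \<Rightarrow> complex" where
  "qpoch a q n = (\<Prod>k<n. 1 - a * q ^ k)"

text \<open>
  The series below converges absolutely for \<open>norm q < 1\<close> and \<open>norm x < 1\<close> whenever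
  its denominators do not vanish; outside its domain of convergence the value is unspecified.
\<close>

definition phi21 :: "complex \<Rightarrow> complex \<Rightarrow> complex \<Rightarrow> complex \<Rightarrow> complex \<Rightarrow> complex" where
  "phi21 a b c q x =
     (\<Sum>k. (qpoch a q k * qpoch b q k * x ^ k) / (qpoch c q k * qpoch q q k))"

definition phi21_denoms_nonzero :: "complex \<Rightarrow> complex \<Rightarrow> bool" where
  "phi21_denoms_nonzero c q \<longleftrightarrow> (\<forall>k. qpoch c q k * qpoch q q k \<noteq> 0)"

end

(* Each 2phi1 solves a second order q-difference equation in its argument. For a = -b and the two
   parameter choices of either part, these equations express both series at the lowest of the three
   arguments through the other two, with the same coefficients up to sign; the products of the two
   series at the highest argument then cancel in the denominator, leaving a multiple of the
   numerator. *)

theory Submission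
  imports Defs
begin

text \<open>Kept apart from \<open>x ^ k\<close> because one and the same coefficient sequence must
  serve the arguments \<open>x\<close>, \<open>q * x\<close> and \<open>q\<^sup>2 * x\<close> at
  once.\<close>

definition phi21_coeff :: "complex \<Rightarrow> complex \<Rightarrow> complex \<Rightarrow> complex \<Rightarrow> nat \<Rightarrow> complex" where
  "phi21_coeff a b c q k = (qpoch a q k * qpoch b q k) / (qpoch c q k * qpoch q q k)"

lemma phi21_conv_coeff: "phi21 a b c q x = (\<Sum>k. phi21_coeff a b c q k * x ^ k)"
  by (simp add: phi21_def phi21_coeff_def)

lemma qpoch_Suc: "qpoch a q (Suc k) = qpoch a q k * (1 - a * q ^ k)"
  by (simp add: qpoch_def)

lemma phi21_denoms_nonzeroD:
  assumes "phi21_denoms_nonzero c q"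
  shows "1 - c * q ^ k \<noteq> 0" and "1 - q ^ Suc k \<noteq> 0"
proof -
  have "qpoch c q (Suc k) * qpoch q q (Suc k) \<noteq> 0"
    using assms unfolding phi21_denoms_nonzero_def by blast
  then show "1 - c * q ^ k \<noteq> 0" and "1 - q ^ Suc k \<noteq> 0"
    by (auto simp: qpoch_Suc)
qed

lemma phi21_coeff_Suc:
  "phi21_coeff a b c q (Suc k) =
     phi21_coeff a b c q k * ((1 - a * q ^ k) * (1 - b * q ^ k) / ((1 - c * q ^ k) * (1 - q ^ Suc k)))"
  by (simp add: phi21_coeff_def qpoch_Suc mult_ac)

lemma phi21_coeff_recurrence:
  assumes "phi21_denoms_nonzero c q"
  shows "phi21_coeff a b c q (Suc k) * ((1 - q ^ Suc k) * (1 - c * q ^ k)) =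
         phi21_coeff a b c q k * ((1 - a * q ^ k) * (1 - b * q ^ k))"
  using phi21_denoms_nonzeroD[OF assms, of k] by (simp add: phi21_coeff_Suc del: power_Suc)

text \<open>Ratio test: since \<open>q ^ k\<close> tends to 0, the quotient of consecutive terms
  tends to \<open>x\<close>, so its norm is eventually below any bound strictly between
  \<open>norm x\<close> and 1.\<close>

lemma summable_phi21:
  assumes "norm q < 1" and "norm x < 1"
  shows "summable (\<lambda>k. phi21_coeff a b c q k * x ^ k)"
proof -
  define r where "r k = (1 - a * q ^ k) * (1 - b * q ^ k) / ((1 - c * q ^ k) * (1 - q ^ Suc k)) * x" for k
  have pow: "(\<lambda>k. q ^ k) \<longlonglongrightarrow> 0"
    using assms(1) by (rule LIMSEQ_power_zero)
  have "r \<longlonglongrightarrow> (1 - a * 0) * (1 - b * 0) / ((1 - c * 0) * (1 - 0)) * x"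
    unfolding r_def using assms(1) by (intro tendsto_intros LIMSEQ_Suc[OF pow]) auto
  then have "(\<lambda>k. norm (r k)) \<longlonglongrightarrow> norm x"
    using tendsto_norm by fastforce
  moreover obtain \<rho> where \<rho>: "norm x < \<rho>" "\<rho> < 1"
    using assms(2) dense by blast
  ultimately have "\<forall>\<^sub>F k in sequentially. norm (r k) < \<rho>"
    by (simp add: order_tendsto_iff)
  then obtain N where N: "\<And>k. k \<ge> N \<Longrightarrow> norm (r k) < \<rho>"
    by (auto simp: eventually_sequentially)
  show ?thesis
  proof (rule summable_ratio_test[OF \<rho>(2)])
    fix k assume "N \<le> k"
    \<comment> \<open>This also holds at a vanishing denominator: division by zero gives 0, so both
      sides are then 0.\<close>
    have "phi21_coeff a b c q (Suc k) * x ^ Suc k = r k * (phi21_coeff a b c q k * x ^ k)"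
      by (simp add: r_def phi21_coeff_Suc)
    then show "norm (phi21_coeff a b c q (Suc k) * x ^ Suc k) \<le> \<rho> * norm (phi21_coeff a b c q k * x ^ k)"
      using N[OF \<open>N \<le> k\<close>] by (simp only: norm_mult[of "r k"]) (intro mult_right_mono; simp)
  qed
qed

text \<open>Multiplying the k-th term by \<open>q ^ k\<close> replaces the argument \<open>x\<close>
  by \<open>q * x\<close>, so the coefficient recurrence, multiplied by \<open>x ^ Suc k\<close> and
  summed, becomes a relation between three arguments. With \<open>c = d * q\<close> the factor
  \<open>1 - c * q ^ k\<close> reads \<open>1 - d * q ^ Suc k\<close>, which makes the left side of
  the recurrence a shifted quadratic in \<open>q ^ k\<close>.\<close>

lemma phi21_q_difference:
  fixes a b d q x :: complex
  assumes q: "norm q < 1" and x: "norm x < 1" and nz: "phi21_denoms_nonzero (d * q) q"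
  defines "F \<equiv> phi21 a b (d * q) q"
  shows "F x - (1 + d) * F (q * x) + d * F (q\<^sup>2 * x) =
         x * (F x - (a + b) * F (q * x) + a * b * F (q\<^sup>2 * x))"
proof -
  define t where "t = phi21_coeff a b (d * q) q"
  have "norm (q ^ n * x) < 1" for n
  proof -
    have "norm (q ^ n * x) \<le> 1 * norm x"
      unfolding norm_mult norm_power using q by (intro mult_right_mono power_le_one) auto
    then show ?thesis using x by simp
  qed
  then have F: "(\<lambda>k. t k * (q ^ n * x) ^ k) sums F (q ^ n * x)" for n
    unfolding F_def t_def phi21_conv_coeff by (intro summable_sums summable_phi21 q)
  have F': "(\<lambda>k. t k * x ^ k * (q ^ k) ^ n) sums F (q ^ n * x)" for n
    using F[of n] by (simp add: power_mult_distrib mult_ac flip: power_mult)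
  \<comment> \<open>Expanding the quadratic in \<open>q ^ k\<close> gives one series for each power.
    It is used with \<open>u, v\<close> equal to \<open>a, b\<close> and to \<open>1, d\<close>, the
    two sides of the recurrence.\<close>
  have comb: "(\<lambda>k. t k * x ^ k * ((1 - u * q ^ k) * (1 - v * q ^ k))) sums
                (F x - (u + v) * F (q * x) + u * v * F (q\<^sup>2 * x))" for u v
  proof -
    have "(\<lambda>k. t k * x ^ k * (q ^ k) ^ 0 - (u + v) * (t k * x ^ k * (q ^ k) ^ 1)
             + u * v * (t k * x ^ k * (q ^ k) ^ 2)) sums
          (F (q ^ 0 * x) - (u + v) * F (q ^ 1 * x) + u * v * F (q\<^sup>2 * x))"
      by (intro sums_add sums_diff sums_mult F')
    then show ?thesis
      by (simp add: algebra_simps power2_eq_square)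
  qed
  have "t (Suc k) * x ^ Suc k * ((1 - 1 * q ^ Suc k) * (1 - d * q ^ Suc k)) =
        x * (t k * x ^ k * ((1 - a * q ^ k) * (1 - b * q ^ k)))" for k
    using phi21_coeff_recurrence[OF nz, of a b k] by (simp add: t_def mult_ac)
  then have "(\<lambda>k. t (Suc k) * x ^ Suc k * ((1 - 1 * q ^ Suc k) * (1 - d * q ^ Suc k))) sums
          (x * (F x - (a + b) * F (q * x) + a * b * F (q\<^sup>2 * x)))"
    using sums_mult[OF comb[of a b], of x] by (simp only:)
  \<comment> \<open>Undoing the index shift adds only the term at 0, which vanishes because of its
    factor \<open>1 - 1 * q ^ 0\<close>.\<close>
  then have "(\<lambda>k. t k * x ^ k * ((1 - 1 * q ^ k) * (1 - d * q ^ k))) sums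
          (x * (F x - (a + b) * F (q * x) + a * b * F (q\<^sup>2 * x)))"
    by (subst (asm) sums_Suc_iff) simp
  from sums_unique2[OF comb[of 1 d] this] show ?thesis by simp
qed

text \<open>For \<open>b = - a\<close> the sum \<open>a + b\<close> vanishes, so \<open>x\<close>
  drops out of the middle coefficient.\<close>

lemma phi21_q_difference_opposite:
  assumes q: "norm q < 1" and x: "norm x < 1" and nz: "phi21_denoms_nonzero (d * q) q"
  shows "(1 - x) * phi21 a (- a) (d * q) q x =
         (1 + d) * phi21 a (- a) (d * q) q (q * x) - (d + x * a\<^sup>2) * phi21 a (- a) (d * q) q (q\<^sup>2 * x)"
  using phi21_q_difference[OF assms, of a "- a"] by (simp add: algebra_simps power2_eq_square)

lemma phi21_commute: "phi21 a b c q x = phi21 b a c q x"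
  by (simp add: phi21_def mult_ac)

text \<open>Indices 1, 2, 3 stand for the lowest, middle and highest argument. The relation for
  \<open>G\<close> is that for \<open>F\<close> with \<open>m\<close> replaced by its inverse,
  multiplied by \<open>m\<close>; thus in the denominator the two \<open>m * r * F3 * G3\<close>
  terms cancel.\<close>

lemma quotient_identity:
  fixes m s r :: complex
  assumes F: "s * F1 = (1 - m) * F2 + m * r * F3"
    and G: "m * s * G1 = r * G3 - (1 - m) * G2"
    and nz: "1 - m \<noteq> 0" "F1 * G3 - m\<^sup>2 * G1 * F3 \<noteq> 0"
  shows "s / (1 - m) = (F2 * G3 + m * G2 * F3) / (F1 * G3 - m\<^sup>2 * G1 * F3)"
proof -
  have "s * (F1 * G3 - m\<^sup>2 * G1 * F3) = (s * F1) * G3 - m * (m * s * G1) * F3"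
    by (simp add: algebra_simps power2_eq_square)
  also have "\<dots> = (1 - m) * (F2 * G3 + m * G2 * F3)"
    unfolding F G by (simp add: algebra_simps)
  finally show ?thesis
    using nz by (simp add: frac_eq_eq mult_ac)
qed

theorem corollary5p1:
  fixes q :: complex
  assumes "0 < norm q" and "norm q < 1"
  shows
    "(\<forall>\<nu> \<nu>' :: complex.
        \<nu> \<noteq> 0 \<longrightarrow> \<nu>' = 1 / \<nu> \<longrightarrow>
        1 - \<nu>^2 \<noteq> 0 \<longrightarrow>
        phi21_denoms_nonzero (- (\<nu>^2) * q) q \<longrightarrow>
        phi21_denoms_nonzero (- (\<nu>'^2) * q) q \<longrightarrow>
        phi21 \<nu> (-\<nu>) (- (\<nu>^2) * q) q (q^2) * phi21 (-\<nu>') \<nu>' (- (\<nu>'^2) * q) q (q^4)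
          - \<nu>^4 * phi21 (-\<nu>') \<nu>' (- (\<nu>'^2) * q) q (q^2) * phi21 \<nu> (-\<nu>) (- (\<nu>^2) * q) q (q^4) \<noteq> 0 \<longrightarrow>
        (1 - q^2) / (1 - \<nu>^2) =
          (phi21 \<nu> (-\<nu>) (- (\<nu>^2) * q) q (q^3) * phi21 (-\<nu>') \<nu>' (- (\<nu>'^2) * q) q (q^4)
            + \<nu>^2 * phi21 (-\<nu>') \<nu>' (- (\<nu>'^2) * q) q (q^3) * phi21 \<nu> (-\<nu>) (- (\<nu>^2) * q) q (q^4)) /
          (phi21 \<nu> (-\<nu>) (- (\<nu>^2) * q) q (q^2) * phi21 (-\<nu>') \<nu>' (- (\<nu>'^2) * q) q (q^4)
            - \<nu>^4 * phi21 (-\<nu>') \<nu>' (- (\<nu>'^2) * q) q (q^2) * phi21 \<nu> (-\<nu>) (- (\<nu>^2) * q) q (q^4)))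
     \<and>
     (\<forall>\<mu> \<mu>' q' :: complex.
        \<mu> \<noteq> 0 \<longrightarrow> \<mu>' = 1 / \<mu> \<longrightarrow> q' = 1 / q \<longrightarrow>
        1 - \<mu>^2 * q' \<noteq> 0 \<longrightarrow>
        phi21_denoms_nonzero (- (\<mu>^2)) q \<longrightarrow>
        phi21_denoms_nonzero (- (q^2) * \<mu>'^2) q \<longrightarrow>
        phi21 \<mu> (-\<mu>) (- (\<mu>^2)) q q * phi21 (- q * \<mu>') (q * \<mu>') (- (q^2) * \<mu>'^2) q (q^3)
          - \<mu>^4 * q'^2 * phi21 (- q * \<mu>') (q * \<mu>') (- (q^2) * \<mu>'^2) q q * phi21 \<mu> (-\<mu>) (- (\<mu>^2)) q (q^3) \<noteq> 0 \<longrightarrow>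
        (1 - q) / (1 - \<mu>^2 * q') =
          (phi21 \<mu> (-\<mu>) (- (\<mu>^2)) q (q^2) * phi21 (- q * \<mu>') (q * \<mu>') (- (q^2) * \<mu>'^2) q (q^3)
            + \<mu>^2 * q' * phi21 (- q * \<mu>') (q * \<mu>') (- (q^2) * \<mu>'^2) q (q^2) * phi21 \<mu> (-\<mu>) (- (\<mu>^2)) q (q^3)) /
          (phi21 \<mu> (-\<mu>) (- (\<mu>^2)) q q * phi21 (- q * \<mu>') (q * \<mu>') (- (q^2) * \<mu>'^2) q (q^3)
            - \<mu>^4 * q'^2 * phi21 (- q * \<mu>') (q * \<mu>') (- (q^2) * \<mu>'^2) q q * phi21 \<mu> (-\<mu>) (- (\<mu>^2)) q (q^3)))"
proof -
  have q0: "q \<noteq> 0" using assms(1) by auto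
  have q2: "norm (q\<^sup>2) < 1"
    using assms by (simp add: norm_power power_less_one_iff)
  have qq: "q * q = q\<^sup>2" "q * q\<^sup>2 = q ^ 3" "q\<^sup>2 * q = q ^ 3" "q\<^sup>2 * q\<^sup>2 = q ^ 4"
    by (simp_all add: eval_nat_numeral)
  show ?thesis
  proof (intro conjI allI impI)
    fix \<nu> \<nu>' :: complex
    define F where "F = phi21 \<nu> (- \<nu>) (- (\<nu>\<^sup>2) * q) q"
    define G where "G = phi21 (- \<nu>') \<nu>' (- (\<nu>'\<^sup>2) * q) q"
    assume \<nu>: "\<nu> \<noteq> 0" "\<nu>' = 1 / \<nu>" "1 - \<nu>\<^sup>2 \<noteq> 0"
      and nzF: "phi21_denoms_nonzero (- (\<nu>\<^sup>2) * q) q"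
      and nzG: "phi21_denoms_nonzero (- (\<nu>'\<^sup>2) * q) q"
      and D: "F (q\<^sup>2) * G (q ^ 4) - \<nu> ^ 4 * G (q\<^sup>2) * F (q ^ 4) \<noteq> 0"
    have G_eq: "G = phi21 \<nu>' (- \<nu>') (- (\<nu>'\<^sup>2) * q) q"
      unfolding G_def using phi21_commute by blast
    have inv: "\<nu>\<^sup>2 * \<nu>'\<^sup>2 = 1"
      using \<nu> by (simp flip: power_mult_distrib)
    \<comment> \<open>Here \<open>x = q\<^sup>2\<close>, \<open>d = - (\<nu>\<^sup>2)\<close> and
      \<open>a = \<nu>\<close>, so the last coefficient \<open>d + x * a\<^sup>2\<close> equals
      \<open>- (\<nu>\<^sup>2) * (1 - q\<^sup>2)\<close>. In \<open>quotient_identity\<close> both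
      \<open>s\<close> and \<open>r\<close> are \<open>1 - q\<^sup>2\<close>, and \<open>m\<close>
      is \<open>\<nu>\<^sup>2\<close>.\<close>
    have "(1 - q\<^sup>2) * F (q\<^sup>2) = (1 - \<nu>\<^sup>2) * F (q ^ 3) + \<nu>\<^sup>2 * (1 - q\<^sup>2) * F (q ^ 4)"
      using phi21_q_difference_opposite[OF assms(2) q2 nzF, of \<nu>]
      by (simp add: F_def qq) (simp add: algebra_simps)
    moreover have "\<nu>\<^sup>2 * (1 - q\<^sup>2) * G (q\<^sup>2) = (1 - q\<^sup>2) * G (q ^ 4) - (1 - \<nu>\<^sup>2) * G (q ^ 3)"
    proof -
      have "(1 - q\<^sup>2) * G (q\<^sup>2) = (1 - \<nu>'\<^sup>2) * G (q ^ 3) + \<nu>'\<^sup>2 * (1 - q\<^sup>2) * G (q ^ 4)"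
        using phi21_q_difference_opposite[OF assms(2) q2 nzG, of \<nu>']
        by (simp add: G_eq qq) (simp add: algebra_simps)
      then show ?thesis using inv by algebra
    qed
    moreover have "\<nu> ^ 4 = (\<nu>\<^sup>2)\<^sup>2" by (simp flip: power_mult)
    ultimately show "(1 - q\<^sup>2) / (1 - \<nu>\<^sup>2) =
        (F (q ^ 3) * G (q ^ 4) + \<nu>\<^sup>2 * G (q ^ 3) * F (q ^ 4)) /
        (F (q\<^sup>2) * G (q ^ 4) - \<nu> ^ 4 * G (q\<^sup>2) * F (q ^ 4))"
      using quotient_identity[OF _ _ \<nu>(3)] D by simp
  next
    fix \<mu> \<mu>' q' :: complex
    define F where "F = phi21 \<mu> (- \<mu>) (- (\<mu>\<^sup>2)) q"
    define G where "G = phi21 (- q * \<mu>') (q * \<mu>') (- (q\<^sup>2) * \<mu>'\<^sup>2) q"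
    \<comment> \<open>Chosen so that the lower parameters are \<open>- m * q\<close> and
      \<open>- m' * q\<close>, the form \<open>d * q\<close> of the q-difference equation;
      \<open>m\<close> and \<open>m'\<close> are mutually inverse.\<close>
    define m where "m = \<mu>\<^sup>2 * q'"
    define m' where "m' = q * \<mu>'\<^sup>2"
    assume \<mu>: "\<mu> \<noteq> 0" "\<mu>' = 1 / \<mu>" "q' = 1 / q" "1 - \<mu>\<^sup>2 * q' \<noteq> 0"
      and nzF: "phi21_denoms_nonzero (- (\<mu>\<^sup>2)) q"
      and nzG: "phi21_denoms_nonzero (- (q\<^sup>2) * \<mu>'\<^sup>2) q"
      and D: "F q * G (q ^ 3) - \<mu> ^ 4 * q'\<^sup>2 * G q * F (q ^ 3) \<noteq> 0"
    have cF: "- (\<mu>\<^sup>2) = - m * q" and cG: "- (q\<^sup>2) * \<mu>'\<^sup>2 = - m' * q"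
      using \<mu> q0 by (simp_all add: m_def m'_def power2_eq_square)
    have G_eq: "G = phi21 (q * \<mu>') (- (q * \<mu>')) (- m' * q) q"
      unfolding G_def cG using phi21_commute by fastforce
    have F_eq: "F = phi21 \<mu> (- \<mu>) (- m * q) q"
      by (simp only: F_def cF)
    have inv: "m * m' = 1"
      using \<mu> q0 by (simp add: m_def m'_def power2_eq_square)
    have sq: "\<mu>\<^sup>2 = m * q" "(q * \<mu>')\<^sup>2 = m' * q"
      using cF by (simp_all add: m'_def power2_eq_square)
    \<comment> \<open>Now \<open>x = q\<close>, \<open>d = - m\<close> and
      \<open>a\<^sup>2 = m * q\<close>, so \<open>d + x * a\<^sup>2\<close> is
      \<open>- m * (1 - q\<^sup>2)\<close>. Unlike before, \<open>s = 1 - q\<close> differs from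
      \<open>r = 1 - q\<^sup>2\<close>.\<close>
    have "(1 - q) * F q = (1 - m) * F (q\<^sup>2) + m * (1 - q\<^sup>2) * F (q ^ 3)"
      using phi21_q_difference_opposite[OF assms(2) assms(2) nzF[unfolded cF], of \<mu>]
      unfolding F_eq[symmetric] qq sq by (simp add: algebra_simps power2_eq_square)
    moreover have "m * (1 - q) * G q = (1 - q\<^sup>2) * G (q ^ 3) - (1 - m) * G (q\<^sup>2)"
    proof -
      have "(1 - q) * G q = (1 - m') * G (q\<^sup>2) + m' * (1 - q\<^sup>2) * G (q ^ 3)"
        using phi21_q_difference_opposite[OF assms(2) assms(2) nzG[unfolded cG], of "q * \<mu>'"]
        unfolding G_eq[symmetric] qq sq by (simp add: algebra_simps power2_eq_square)
      \<comment> \<open>Multiplication by \<open>m\<close> turns \<open>1 - m'\<close> into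
        \<open>m - 1\<close> and removes the factor \<open>m'\<close>.\<close>
      then show ?thesis using inv by algebra
    qed
    moreover have "\<mu> ^ 4 * q'\<^sup>2 = m\<^sup>2" by (simp add: m_def power_mult_distrib flip: power_mult)
    ultimately show "(1 - q) / (1 - \<mu>\<^sup>2 * q') =
        (F (q\<^sup>2) * G (q ^ 3) + \<mu>\<^sup>2 * q' * G (q\<^sup>2) * F (q ^ 3)) /
        (F q * G (q ^ 3) - \<mu> ^ 4 * q'\<^sup>2 * G q * F (q ^ 3))"
      using quotient_identity[OF _ _ \<mu>(4)[folded m_def]] D unfolding m_def[symmetric] by simp
  qed
qed

end
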